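(* Consider randomized schemes storing sets of $n$ elements from a universe $\{1,\ldots,m\}$ with two-part memory: a cached word $C$ of size $\mathrm{poly}(\log m)$ and a main storage $B$ of $s$ bits, both depending on the stored set. For every constant $\varepsilon<1$, if $\mathrm{poly}(\log m)\ll n\ll\sqrt[3]{m}$, then any such scheme with error probability $\varepsilon$ (possibly two-sided) that answers each membership query using the cached memory and one bit probe to the main storage must use space $s=\Omega\!\left(\frac{n}{\varepsilon\log(1/\varepsilon)}\log m\right)$.
   Context: In such a scheme, each set $A\subseteq\{1,\ldots,m\}$ with $|A|=n$ is represented by a pair $(C,B)$. A query ``$x\in A$?'' is answered by a randomized algorithm that reads all of $C$, uses $x$, $C$ and its coin tosses to choose one position in $B$, reads that single bit, and outputs an answer. The scheme has (two-sided) error probability $\varepsilon$ if for every stored $A$ and every $x\in\{1,\ldots,m\}$ the answer is correct with probability at least $1-\varepsilon$.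
   Formalization: For 1/2 ≤ ε < 1 the scheme is required to have one-sided error, since a fair coin answers with two-sided error 1/2 using one bit and no cache; for ε < 1/2 two-sided error is allowed. Also ε > 0 is assumed, so that the bound is defined. *)

theory Defs
  imports "HOL-Probability.Probability" "HOL-Library.Landau_Symbols"
begin

text \<open>
  The coin tosses of the query algorithm are split into those that select the probed position and
  those that produce the answer afterwards. This loses no generality: any joint distribution of a
  position and an answer depending on \<open>x\<close>, \<open>C\<close> and the bit read disintegrates in this way. No
  computability or uniformity is required of any component.
\<close>

record probe_scheme =
  cache  :: "nat set \<Rightarrow> bool list"
  store  :: "nat set \<Rightarrow> bool list"
  probe  :: "nat \<Rightarrow> bool list \<Rightarrow> nat pmf"
  answer :: "nat \<Rightarrow> bool list \<Rightarrow> nat \<Rightarrow> bool \<Rightarrow> bool pmf"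

definition query :: "probe_scheme \<Rightarrow> nat set \<Rightarrow> nat \<Rightarrow> bool pmf" where
  "query S A x =
     (let C = cache S A; B = store S A
      in bind_pmf (probe S x C) (\<lambda>i. answer S x C i (B ! i)))"

definition nsets :: "nat \<Rightarrow> nat \<Rightarrow> nat set set" where
  "nsets m n = {A. A \<subseteq> {1..m} \<and> card A = n}"

text \<open>Positions in the main storage are numbered from \<open>0\<close>; \<open>r\<close> bounds the length of the cached word.\<close>

definition is_scheme :: "nat \<Rightarrow> nat \<Rightarrow> nat \<Rightarrow> nat \<Rightarrow> probe_scheme \<Rightarrow> bool" where
  "is_scheme m n r s S \<longleftrightarrow>
     (\<forall>A\<in>nsets m n.
        length (cache S A) \<le> r \<and> length (store S A) = s \<and>
        (\<forall>x\<in>{1..m}. set_pmf (probe S x (cache S A)) \<subseteq> {..<s}))"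

definition has_error :: "nat \<Rightarrow> nat \<Rightarrow> real \<Rightarrow> probe_scheme \<Rightarrow> bool" where
  "has_error m n \<epsilon> S \<longleftrightarrow>
     (\<forall>A\<in>nsets m n. \<forall>x\<in>{1..m}. pmf (query S A x) (x \<in> A) \<ge> 1 - \<epsilon>)"

text \<open>The side on which no error occurs is the same for all sets and queries.\<close>

definition one_sided :: "nat \<Rightarrow> nat \<Rightarrow> probe_scheme \<Rightarrow> bool" where
  "one_sided m n S \<longleftrightarrow>
     (\<forall>A\<in>nsets m n. \<forall>x\<in>A. pmf (query S A x) True = 1) \<or>
     (\<forall>A\<in>nsets m n. \<forall>x\<in>{1..m} - A. pmf (query S A x) False = 1)"

text \<open>
  Two-sided error at least \<open>1/2\<close> is achieved with a single bit of storage by answering with a fair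
  coin, so no nontrivial lower bound on the storage can hold there.
\<close>

lemma fair_coin_scheme:
  assumes "1 / 2 \<le> \<epsilon>"
  shows "\<exists>S. is_scheme m n 0 1 S \<and> has_error m n \<epsilon> S"
proof -
  define S where "S = \<lparr>cache = (\<lambda>_. []), store = (\<lambda>_. [False]),
    probe = (\<lambda>_ _. return_pmf 0), answer = (\<lambda>_ _ _ _. bernoulli_pmf (1 / 2))\<rparr>"
  have "query S A x = bernoulli_pmf (1 / 2)" for A x
    by (simp add: query_def S_def bind_return_pmf)
  moreover have "pmf (bernoulli_pmf (1 / 2)) b = 1 / 2" for b
    by (cases b) auto
  ultimately have "has_error m n \<epsilon> S"
    using assms by (simp add: has_error_def)
  moreover have "is_scheme m n 0 1 S"
    by (simp add: is_scheme_def S_def)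
  ultimately show ?thesis by blast
qed

end

theory Submission
  imports Defs
begin

text \<open>
  A set \<open>A\<close> with storage \<open>B\<close> is recovered from a sparse part of \<open>B\<close>. Let \<open>h\<^sub>x(i,b)\<close> be the
  probability that on query \<open>x\<close> position \<open>i\<close> is probed and \<open>True\<close> is answered if the bit there
  is \<open>b\<close>. Over the graph of \<open>B\<close>, \<open>h\<^sub>x\<close> sums to at least \<open>1 - \<epsilon>\<close> if \<open>x \<in> A\<close> and to at most \<open>\<epsilon>\<close>
  otherwise; so if a part \<open>T\<close> of the graph already carries more than \<open>\<epsilon>\<close> for \<open>x\<close>, then \<open>x \<in> A\<close>.
  Balancing the mass carried by \<open>T\<close> against its size yields such a \<open>T\<close> with at most \<open>n + 12\<epsilon>s\<close> points which certifies two thirds of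
  \<open>A\<close>. Hence \<open>A\<close> is determined by the cached word, by \<open>T\<close>, and by the remaining \<open>n/3\<close> elements,
  and there are only about \<open>2 ^ O(\<epsilon> s log (1/\<epsilon>))\<close> possible \<open>T\<close>. For \<open>\<epsilon>\<close> bounded away from \<open>0\<close> it
  suffices to count the pairs of cached word and storage.
\<close>

section \<open>Sparse certifying parts of a weighted set\<close>

text \<open>An optimal trade-off of mass against size gives both bounds: comparison with the
  smallest admissible set limits the size of \<open>T\<close>, comparison with one-point extensions
  limits the elements left uncertified.\<close>

lemma sparse_core:
  fixes h :: "'a \<Rightarrow> 'b \<Rightarrow> real"
  assumes fin: "finite A" "finite G"
    and h0: "\<And>x i. 0 \<le> h x i"
    and big: "\<And>x. x \<in> A \<Longrightarrow> 1 - \<epsilon> \<le> sum (h x) G"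
    and eps: "0 < \<epsilon>" "\<epsilon> \<le> 1 / 4"
  shows "\<exists>T\<subseteq>G. real (card T) \<le> real (card A) + 12 * \<epsilon> * real (card G) \<and>
           real (card {x \<in> A. sum (h x) T \<le> \<epsilon>}) \<le> real (card A) / 3"
proof (cases "A = {}")
  case True
  then show ?thesis using eps by (intro exI[of _ "{}"]) auto
next
  case False
  then have "sum (h x) G > 0" if "x \<in> A" for x
    using big[OF that] eps by linarith
  with False have "G \<noteq> {}" by fastforce
  define n where "n = real (card A)"
  define g where "g = real (card G)"
  have g: "g > 0" and n: "n > 0"
    using \<open>G \<noteq> {}\<close> False fin by (auto simp: g_def n_def card_gt_0_iff)
  \<comment> \<open>At this price all of \<open>G\<close> costs \<open>n / 6\<close>, while the
    total capped mass, at most \<open>2 * \<epsilon> * n\<close>, pays for at most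
    \<open>12 * \<epsilon> * g\<close> points.\<close>
  define l where "l = n / (6 * g)"
  have l: "l > 0" using g n by (simp add: l_def)
  define \<Phi> where "\<Phi> T = (\<Sum>x\<in>A. min (sum (h x) T) (2 * \<epsilon>))" for T
  \<comment> \<open>\<open>p x\<close> will be a point of \<open>G\<close> heavier than \<epsilon>
    for \<open>x\<close> if there is one, and arbitrary otherwise.\<close>
  have "\<exists>i. i \<in> G \<and> (\<forall>j\<in>G. h x j > \<epsilon> \<longrightarrow> h x i > \<epsilon>)" for x
    using \<open>G \<noteq> {}\<close> by blast
  then obtain p where p: "\<And>x. p x \<in> G" "\<And>x j. j \<in> G \<Longrightarrow> h x j > \<epsilon> \<Longrightarrow> h x (p x) > \<epsilon>"
    by metis
  \<comment> \<open>\<open>T\<close> maximizes the capped mass at a price \<open>l\<close> per point. Including \<open>p ` A\<close> serves every \<open>x\<close> that has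
    a single point heavier than \<open>\<epsilon>\<close>; for the other \<open>x\<close> the cap \<open>2\<epsilon>\<close> is not reached by adding one
    point while \<open>x\<close> is not yet served, so that many unserved \<open>x\<close> would make some point worth its price.\<close>
  define \<F> where "\<F> = {T. p ` A \<subseteq> T \<and> T \<subseteq> G}"
  have finF: "finite \<F>" unfolding \<F>_def using fin by (auto intro: finite_subset[of _ "Pow G"])
  have T0: "p ` A \<in> \<F>" using p by (auto simp: \<F>_def)
  define v where "v T = \<Phi> T - l * real (card T)" for T
  have "Max (v ` \<F>) \<in> v ` \<F>" using finF T0 by (intro Max_in) auto
  then obtain T where T: "T \<in> \<F>" "v T = Max (v ` \<F>)" by auto
  have maxT: "v T' \<le> v T" if "T' \<in> \<F>" for T'
    using that finF T(2) by simp
  have TG: "T \<subseteq> G" "p ` A \<subseteq> T" using T(1) by (auto simp: \<F>_def)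
  then have finT: "finite T" using fin finite_subset by blast
  define H where "H = {x \<in> A. sum (h x) T \<le> \<epsilon>}"
  have finH: "finite H" "H \<subseteq> A" using fin by (auto simp: H_def)
  have light: "h x i \<le> \<epsilon>" if "x \<in> H" "i \<in> G" for x i
  proof (rule ccontr)
    assume "\<not> h x i \<le> \<epsilon>"
    then have "h x (p x) > \<epsilon>" using p(2) that by force
    moreover have "p x \<in> T" using that TG finH by auto
    then have "h x (p x) \<le> sum (h x) T"
      using finT h0 by (intro member_le_sum) auto
    ultimately show False using that by (auto simp: H_def)
  qed
  have "real (card T) \<le> n + 12 * \<epsilon> * g"
  proof -
    have "0 \<le> \<Phi> (p ` A)" using h0 eps by (auto simp: \<Phi>_def intro!: sum_nonneg)
    moreover have "\<Phi> T \<le> 2 * \<epsilon> * n"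
    proof -
      have "\<Phi> T \<le> (\<Sum>x\<in>A. 2 * \<epsilon>)" unfolding \<Phi>_def by (intro sum_mono) auto
      then show ?thesis by (simp add: n_def mult.commute)
    qed
    moreover have "real (card (p ` A)) \<le> n" using fin by (simp add: card_image_le n_def)
    then have "l * real (card (p ` A)) \<le> l * n" using l by simp
    ultimately have "l * real (card T) \<le> 2 * \<epsilon> * n + l * n"
      using maxT[OF T0] unfolding v_def by linarith
    also have "2 * \<epsilon> * n = l * (12 * \<epsilon> * g)" using g by (simp add: l_def)
    finally have "l * real (card T) \<le> l * (n + 12 * \<epsilon> * g)" by (simp add: algebra_simps)
    then show ?thesis using l by simp
  qed
  moreover have "real (card H) \<le> n / 3"
  proof -
    have gain: "(\<Sum>x\<in>H. h x i) \<le> l" if i: "i \<in> G - T" for i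
    proof -
      have ins: "sum (h x) (insert i T) = sum (h x) T + h x i" for x
        using i finT by simp
      have "(\<Sum>x\<in>H. h x i) = (\<Sum>x\<in>A. if x \<in> H then h x i else 0)"
        using finH fin by (simp add: sum.If_cases Int_absorb1)
      also have "\<dots> \<le> (\<Sum>x\<in>A. min (sum (h x) (insert i T)) (2 * \<epsilon>) - min (sum (h x) T) (2 * \<epsilon>))"
      proof (intro sum_mono)
        fix x
        show "(if x \<in> H then h x i else 0)
              \<le> min (sum (h x) (insert i T)) (2 * \<epsilon>) - min (sum (h x) T) (2 * \<epsilon>)"
        proof (cases "x \<in> H")
          case True
          then show ?thesis using light[OF True, of i] i eps h0[of x i] by (auto simp: ins H_def)
        next
          case False
          then show ?thesis using h0[of x i] by (auto simp: ins)
        qed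
      qed
      also have "\<dots> = \<Phi> (insert i T) - \<Phi> T" by (simp add: \<Phi>_def sum_subtractf)
      also have "\<dots> \<le> l"
      proof -
        have "insert i T \<in> \<F>" using i TG by (auto simp: \<F>_def)
        from maxT[OF this] show ?thesis using i finT by (simp add: v_def algebra_simps)
      qed
      finally show ?thesis .
    qed
    have "real (card H) * (1 / 2) = (\<Sum>x\<in>H. 1 / 2)" by simp
    also have "\<dots> \<le> (\<Sum>x\<in>H. sum (h x) (G - T))"
    proof (intro sum_mono)
      \<comment> \<open>Of a mass of at least \<open>1 - \<epsilon>\<close>, at most \<epsilon> lies
        in \<open>T\<close>, and \<open>1 - 2 * \<epsilon> \<ge> 1 / 2\<close>.\<close>
      fix x assume "x \<in> H"
      then show "1 / 2 \<le> sum (h x) (G - T)"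
        using big[of x] eps TG fin by (auto simp: H_def sum_diff)
    qed
    also have "\<dots> = (\<Sum>i\<in>G - T. \<Sum>x\<in>H. h x i)" by (rule sum.swap)
    also have "\<dots> \<le> (\<Sum>i\<in>G - T. l)" by (intro sum_mono gain)
    also have "\<dots> \<le> g * l" using l fin by (simp add: g_def card_mono)
    also have "\<dots> = n / 6" using g by (simp add: l_def)
    finally show ?thesis by simp
  qed
  ultimately show ?thesis using TG unfolding n_def g_def H_def by blast
qed

section \<open>Counting small subsets and bit strings\<close>

lemma sum_Pow_power_card:
  fixes z :: "'a :: comm_semiring_1"
  assumes "finite U"
  shows "(\<Sum>T\<in>Pow U. z ^ card T) = (1 + z) ^ card U"
  using prod_add[OF assms, of "\<lambda>_. z" "\<lambda>_. 1"] by (simp add: add.commute)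

text \<open>Give each subset the weight \<open>z ^ card T\<close>: a counted one weighs at least
  \<open>z powr t\<close>, and all subsets together weigh \<open>(1 + z) ^ card U\<close>.\<close>

lemma card_small_subsets_le:
  fixes z t :: real
  assumes "finite U" "0 < z" "z \<le> 1"
  shows "real (card {T. T \<subseteq> U \<and> real (card T) \<le> t}) \<le> (1 / z) powr t * (1 + z) ^ card U"
proof -
  have "real (card {T. T \<subseteq> U \<and> real (card T) \<le> t}) * z powr t
        = (\<Sum>T\<in>{T. T \<subseteq> U \<and> real (card T) \<le> t}. z powr t)" by simp
  also have "\<dots> \<le> (\<Sum>T\<in>{T. T \<subseteq> U \<and> real (card T) \<le> t}. z ^ card T)"
    using assms by (intro sum_mono) (auto simp: powr_realpow[symmetric] intro!: powr_mono')
  also have "\<dots> \<le> (\<Sum>T\<in>Pow U. z ^ card T)"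
    using assms by (intro sum_mono2) auto
  finally show ?thesis
    using assms by (simp add: sum_Pow_power_card powr_divide field_simps)
qed

lemma card_bool_lists_le: "card {C :: bool list. length C \<le> r} \<le> 2 ^ (r + 1)"
proof -
  have "card {C :: bool list. length C \<le> r} = (\<Sum>i\<le>r. 2 ^ i)"
    using card_lists_length_le[of "UNIV :: bool set" r] by simp
  also have "\<dots> \<le> 2 ^ (r + 1)" by (induction r) auto
  finally show ?thesis .
qed

lemma card_bool_lists_eq: "card {C :: bool list. length C = s} = 2 ^ s"
  using card_lists_length_eq[of "UNIV :: bool set" s] by simp

lemma finite_bool_lists_le: "finite {C :: bool list. length C \<le> r}"
  using finite_lists_length_le[of "UNIV :: bool set" r] by simp

lemma finite_bool_lists_eq: "finite {C :: bool list. length C = s}"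
  using finite_lists_length_eq[of "UNIV :: bool set" s] by simp

section \<open>Encodings of the stored sets\<close>

lemma card_nsets: "card (nsets m n) = m choose n"
  unfolding nsets_def by (subst n_subsets) auto

lemma pmf_query_True:
  assumes "is_scheme m n r s S" "A \<in> nsets m n" "x \<in> {1..m}"
  shows "pmf (query S A x) True =
    (\<Sum>i<s. pmf (probe S x (cache S A)) i *
      pmf (answer S x (cache S A) i (store S A ! i)) True)"
proof -
  have "set_pmf (probe S x (cache S A)) \<subseteq> {..<s}"
    using assms by (auto simp: is_scheme_def)
  then show ?thesis
    unfolding query_def Let_def pmf_bind
    by (subst integral_measure_pmf[of "{..<s}"]) auto
qed

text \<open>Otherwise both answers would have probability at least \<open>1 - \<epsilon>\<close>
  under one distribution. This exceeds total mass 1 if \<open>\<epsilon> < 1 / 2\<close>; in the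
  one-sided case one answer has probability 1 and leaves nothing for the other.\<close>

lemma mem_of_query_eq:
  assumes err: "has_error m n \<epsilon> S" and side: "\<epsilon> < 1 / 2 \<or> one_sided m n S" and "\<epsilon> < 1"
    and A: "A \<in> nsets m n" "A' \<in> nsets m n"
    and eq: "query S A x = query S A' x" and x: "x \<in> A"
  shows "x \<in> A'"
proof (rule ccontr)
  assume nx: "x \<notin> A'"
  have xm: "x \<in> {1..m}" using x A by (auto simp: nsets_def)
  have 1: "pmf (query S A x) True \<ge> 1 - \<epsilon>" using err A x xm by (force simp: has_error_def)
  have 2: "pmf (query S A x) False \<ge> 1 - \<epsilon>" using err A nx xm by (force simp: has_error_def eq)
  have "one_sided m n S" using 1 2 side by (auto simp: pmf_False_conv_True)
  then have "pmf (query S A x) True = 1 \<or> pmf (query S A x) False = 1"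
    using A x nx xm unfolding one_sided_def eq[symmetric] by (metis Diff_iff eq)
  then show False using 1 2 \<open>\<epsilon> < 1\<close> by (auto simp: pmf_False_conv_True)
qed

lemma choose_le_information:
  assumes sch: "is_scheme m n r s S" and err: "has_error m n \<epsilon> S"
    and side: "\<epsilon> < 1 / 2 \<or> one_sided m n S" and "\<epsilon> < 1"
  shows "m choose n \<le> 2 ^ (r + 1) * 2 ^ s"
proof -
  have "inj_on (\<lambda>A. (cache S A, store S A)) (nsets m n)"
  proof (rule inj_onI)
    fix A A' assume *: "A \<in> nsets m n" "A' \<in> nsets m n"
      "(cache S A, store S A) = (cache S A', store S A')"
    then have "query S A x = query S A' x" for x by (simp add: query_def)
    then show "A = A'"
      using mem_of_query_eq[OF err side \<open>\<epsilon> < 1\<close>] * by (metis subsetI subset_antisym)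
  qed
  then have "card (nsets m n)
      \<le> card ({C :: bool list. length C \<le> r} \<times> {B :: bool list. length B = s})"
    using sch finite_bool_lists_le finite_bool_lists_eq
    by (intro card_inj_on_le) (auto simp: is_scheme_def)
  also have "\<dots> \<le> 2 ^ (r + 1) * 2 ^ s"
    unfolding card_cartesian_product card_bool_lists_eq
    by (intro mult_right_mono card_bool_lists_le) auto
  finally show ?thesis by (simp add: card_nsets)
qed

text \<open>The factors count cached words, sparse parts \<open>T\<close> (weight \<epsilon> on the
  \<open>2 * s\<close> pairs of a position and a bit), and uncertified remainders \<open>R\<close>
  (weight \<open>1 / real m\<close>).\<close>

lemma choose_le_sparse:
  assumes sch: "is_scheme m n r s S" and err: "has_error m n \<epsilon> S"
    and eps: "0 < \<epsilon>" "\<epsilon> \<le> 1 / 4" and "m > 0"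
  shows "real (m choose n) \<le> 2 ^ (r + 1) *
    (((1 / \<epsilon>) powr (real n + 12 * \<epsilon> * real s) * (1 + \<epsilon>) ^ (2 * s)) *
     (real m powr (real n / 3) * (1 + 1 / real m) ^ m))"
proof -
  \<comment> \<open>The point \<open>ib\<close> carries its own bit, so the mass of \<open>T\<close>
    can be evaluated from \<open>C\<close> and \<open>T\<close> without the rest of the
    storage.\<close>
  define h where "h C x ib =
    pmf (probe S x C) (fst ib) * pmf (answer S x C (fst ib) (snd ib)) True" for C x ib
  define graph where "graph A = (\<lambda>i. (i, store S A ! i)) ` {..<s}" for A
  have graph: "finite (graph A)" "card (graph A) = s" for A
    by (auto simp: graph_def card_image inj_on_def)
  have sum_graph: "sum (h (cache S A) x) (graph A) = pmf (query S A x) True"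
    if "A \<in> nsets m n" "x \<in> {1..m}" for A x
    unfolding pmf_query_True[OF sch that] graph_def
    by (subst sum.reindex) (auto simp: h_def inj_on_def)
  have h0: "0 \<le> h C x ib" for C x ib by (simp add: h_def)
  define core where "core A T \<longleftrightarrow> T \<subseteq> graph A \<and> real (card T) \<le> real n + 12 * \<epsilon> * real s \<and>
    real (card {x \<in> A. sum (h (cache S A) x) T \<le> \<epsilon>}) \<le> real n / 3" for A T
  have "\<exists>T. core A T"
    if A: "A \<in> nsets m n" for A
  proof -
    have "finite A" "card A = n" "A \<subseteq> {1..m}"
      using A by (auto simp: nsets_def intro: finite_subset)
    moreover have "1 - \<epsilon> \<le> sum (h (cache S A) x) (graph A)" if "x \<in> A" for x
      using sum_graph[OF A, of x] err A that \<open>A \<subseteq> {1..m}\<close> by (force simp: has_error_def)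
    ultimately show ?thesis
      using sparse_core[of A "graph A" "h (cache S A)" \<epsilon>] graph[of A] h0 eps
      by (auto simp: core_def)
  qed
  then obtain T where "\<And>A. A \<in> nsets m n \<Longrightarrow> core A (T A)"
    by metis
  then have T: "\<And>A. A \<in> nsets m n \<Longrightarrow> T A \<subseteq> graph A"
    "\<And>A. A \<in> nsets m n \<Longrightarrow> real (card (T A)) \<le> real n + 12 * \<epsilon> * real s"
    "\<And>A. A \<in> nsets m n \<Longrightarrow> real (card {x \<in> A. sum (h (cache S A) x) (T A) \<le> \<epsilon>}) \<le> real n / 3"
    by (auto simp: core_def)
  define R where "R A = {x \<in> A. sum (h (cache S A) x) (T A) \<le> \<epsilon>}" for A
  \<comment> \<open>Apart from \<open>m\<close> and \<epsilon>, the right-hand side uses only the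
    cached word, \<open>T A\<close> and \<open>R A\<close>, whence injectivity.\<close>
  have decode: "A = R A \<union> {x \<in> {1..m}. sum (h (cache S A) x) (T A) > \<epsilon>}"
    if A: "A \<in> nsets m n" for A
  proof -
    have "sum (h (cache S A) x) (T A) \<le> \<epsilon>" if x: "x \<in> {1..m}" "x \<notin> A" for x
    proof -
      have "sum (h (cache S A) x) (T A) \<le> sum (h (cache S A) x) (graph A)"
        using T(1)[OF A] graph h0 by (intro sum_mono2) auto
      also have "\<dots> = 1 - pmf (query S A x) False"
        using sum_graph[OF A x(1)] by (simp add: pmf_False_conv_True)
      also have "\<dots> \<le> \<epsilon>" using err A x by (force simp: has_error_def)
      finally show ?thesis .
    qed
    moreover have "A \<subseteq> {1..m}" using A by (auto simp: nsets_def)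
    ultimately show ?thesis by (force simp: R_def)
  qed
  have inj: "inj_on (\<lambda>A. (cache S A, T A, R A)) (nsets m n)"
  proof (rule inj_onI)
    fix A A' assume *: "A \<in> nsets m n" "A' \<in> nsets m n"
      "(cache S A, T A, R A) = (cache S A', T A', R A')"
    show "A = A'" using decode[OF *(1)] decode[OF *(2)] *(3) by auto
  qed
  define \<T> where "\<T> = {T. T \<subseteq> {..<s} \<times> (UNIV :: bool set) \<and>
    real (card T) \<le> real n + 12 * \<epsilon> * real s}"
  define \<R> where "\<R> = {R. R \<subseteq> {1..m} \<and> real (card R) \<le> real n / 3}"
  have fin: "finite \<T>" "finite \<R>"
    by (auto simp: \<T>_def \<R>_def intro: finite_subset[of _ "Pow _"])
  have "card (nsets m n) \<le> card ({C :: bool list. length C \<le> r} \<times> \<T> \<times> \<R>)"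
  proof (rule card_inj_on_le[OF inj])
    show "(\<lambda>A. (cache S A, T A, R A)) ` nsets m n \<subseteq> {C. length C \<le> r} \<times> \<T> \<times> \<R>"
    proof (intro image_subsetI, unfold mem_Times_iff, intro conjI)
      fix A assume A: "A \<in> nsets m n"
      show "fst (cache S A, T A, R A) \<in> {C. length C \<le> r}" using sch A by (auto simp: is_scheme_def)
      show "fst (snd (cache S A, T A, R A)) \<in> \<T>"
        using T(1,2)[OF A] by (auto simp: \<T>_def graph_def)
      show "snd (snd (cache S A, T A, R A)) \<in> \<R>"
        using T(3)[OF A] A by (auto simp: \<R>_def R_def nsets_def)
    qed
  qed (use fin finite_bool_lists_le in auto)
  then have "real (m choose n) \<le> real (card {C :: bool list. length C \<le> r}) *
      (real (card \<T>) * real (card \<R>))"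
    by (simp add: card_nsets card_cartesian_product flip: of_nat_mult)
  also have "\<dots> \<le> 2 ^ (r + 1) *
    (((1 / \<epsilon>) powr (real n + 12 * \<epsilon> * real s) * (1 + \<epsilon>) ^ (2 * s)) *
     (real m powr (real n / 3) * (1 + 1 / real m) ^ m))"
  proof (intro mult_mono)
    show "real (card {C :: bool list. length C \<le> r}) \<le> 2 ^ (r + 1)"
      using of_nat_mono[OF card_bool_lists_le[of r], where 'a = real] by simp
    show "real (card \<T>) \<le> (1 / \<epsilon>) powr (real n + 12 * \<epsilon> * real s) * (1 + \<epsilon>) ^ (2 * s)"
      using card_small_subsets_le[of "{..<s} \<times> (UNIV :: bool set)" \<epsilon> "real n + 12 * \<epsilon> * real s"] eps
      by (simp add: \<T>_def card_cartesian_product mult.commute)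
    show "real (card \<R>) \<le> real m powr (real n / 3) * (1 + 1 / real m) ^ m"
      using card_small_subsets_le[of "{1..m}" "1 / real m" "real n / 3"] \<open>m > 0\<close>
      by (simp add: \<R>_def)
  qed (use eps in auto)
  finally show ?thesis .
qed

section \<open>Logarithmic estimates and space bounds\<close>

lemma log2_one_plus_power_le:
  assumes "0 \<le> z"
  shows "log 2 ((1 + z) ^ j) \<le> 3 / 2 * (real j * z)"
proof -
  have "ln (1 + z) \<le> z" using assms by (rule ln_add_one_self_le_self)
  moreover have "2 / 3 \<le> ln (2 :: real)" by (rule ln2_ge_two_thirds)
  ultimately have "ln (1 + z) / ln 2 \<le> z / (2 / 3)"
    using assms by (intro frac_le) auto
  then have "real j * log 2 (1 + z) \<le> real j * (z / (2 / 3))"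
    by (intro mult_left_mono) (auto simp: log_def)
  then show ?thesis using assms by (simp add: log_nat_power)
qed

lemma le_of_le_root3:
  assumes "real n \<le> root 3 (real m)"
  shows "n ^ 3 \<le> m" "n \<le> m"
proof -
  have "real n ^ 3 \<le> root 3 (real m) ^ 3" using assms by (intro power_mono) auto
  then show "n ^ 3 \<le> m" by (simp flip: of_nat_power)
  moreover have "n \<le> n ^ 3" by (cases "n = 0") (auto simp: self_le_power)
  ultimately show "n \<le> m" by linarith
qed

text \<open>The cube root makes \<open>m / n\<close> at least the power \<open>2 / 3\<close> of
  \<open>m\<close>. This is twice the exponent \<open>n / 3\<close> that the remainder
  \<open>R\<close> costs in \<open>choose_le_sparse\<close>.\<close>

lemma log2_choose_ge:
  assumes "m > 0" "real n \<le> root 3 (real m)"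
  shows "2 / 3 * (real n * log 2 (real m)) \<le> log 2 (real (m choose n))"
proof (cases "n = 0")
  case False
  have n3: "real n ^ 3 \<le> real m"
    using le_of_le_root3(1)[OF assms(2)] by (simp flip: of_nat_power)
  have "log 2 (real n ^ 3) \<le> log 2 (real m)" using n3 False assms by simp
  then have ln: "log 2 (real n) \<le> log 2 (real m) / 3" using False by (simp add: log_nat_power)
  have "n \<le> m" using assms(2) by (rule le_of_le_root3)
  then have "(real m / real n) ^ n \<le> real (m choose n)"
    by (rule binomial_ge_n_over_k_pow_k)
  then have "log 2 ((real m / real n) ^ n) \<le> log 2 (real (m choose n))"
    using False assms \<open>n \<le> m\<close> by (subst log_le_cancel_iff) auto
  moreover have "log 2 ((real m / real n) ^ n) = real n * (log 2 (real m) - log 2 (real n))"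
    using False assms by (simp add: log_nat_power log_divide)
  moreover have "real n * (2 / 3 * log 2 (real m)) \<le> real n * (log 2 (real m) - log 2 (real n))"
    using ln by (intro mult_left_mono) auto
  ultimately show ?thesis by simp
qed auto

text \<open>The cached word costs at most \<open>r + 1 \<le> 2 * n\<close> bits, hence at most a
  sixth of \<open>n * log 2 m\<close>; and \<open>2 / 3 - 1 / 6 = 1 / 2\<close>.\<close>

lemma space_bound_information:
  assumes "is_scheme m n r s S" "has_error m n \<epsilon> S" "\<epsilon> < 1 / 2 \<or> one_sided m n S" "\<epsilon> < 1"
    and "m > 0" "real n \<le> root 3 (real m)" "r \<le> n" "n > 0" "12 \<le> log 2 (real m)"
  shows "real n * log 2 (real m) / 2 \<le> real s"
proof -
  have "n \<le> m" using assms(6) by (rule le_of_le_root3)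
  have "real (m choose n) \<le> 2 ^ (r + 1 + s)"
    using of_nat_mono[OF choose_le_information[OF assms(1-4)], where 'a = real]
    by (simp add: power_add)
  then have "log 2 (real (m choose n)) \<le> log 2 (2 ^ (r + 1 + s))"
    using \<open>n \<le> m\<close> by (subst log_le_cancel_iff) auto
  also have "\<dots> = real r + 1 + real s"
    by (simp only: log_nat_power log_pow_cancel) simp
  finally have "log 2 (real (m choose n)) \<le> real r + 1 + real s" .
  moreover have "real n * 12 \<le> real n * log 2 (real m)" using assms by (intro mult_left_mono) auto
  moreover have "real r \<le> real n" "1 \<le> real n" using assms by auto
  ultimately show ?thesis using log2_choose_ge[OF assms(5,6)] by linarith
qed

text \<open>After paying for \<open>R\<close>, a third of \<open>n * log 2 m\<close> is left. By
  \<open>large\<close>, half of it absorbs all terms free of \<open>s\<close>. The other sixth is at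
  most \<open>12 + 3 / 2\<close> times \<open>\<epsilon> * L * s\<close>, and
  \<open>84 = 6 * 14\<close> rounds this up.\<close>

lemma space_bound_sparse:
  assumes sch: "is_scheme m n r s S" "has_error m n \<epsilon> S" and eps: "0 < \<epsilon>" "\<epsilon> \<le> 1 / 4"
    and m: "m > 0" "real n \<le> root 3 (real m)" "r \<le> n" "n > 0"
    and large: "6 * (5 + log 2 (1 / \<epsilon>)) \<le> log 2 (real m)"
  shows "real n * log 2 (real m) \<le> 84 * (\<epsilon> * log 2 (1 / \<epsilon>)) * real s"
proof -
  define L where "L = log 2 (1 / \<epsilon>)"
  have "log 2 4 \<le> L" unfolding L_def using eps by (subst log_le_cancel_iff) (auto simp: field_simps)
  moreover have "log 2 (4 :: real) = 2" using log_pow_cancel[of 2 2] by simp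
  ultimately have L: "2 \<le> L" by simp
  define P where "P = (1 / \<epsilon>) powr (real n + 12 * \<epsilon> * real s)"
  define Q where "Q = (1 + \<epsilon>) ^ (2 * s)"
  define M where "M = real m powr (real n / 3)"
  define E where "E = (1 + 1 / real m) ^ m"
  have pos: "P > 0" "Q > 0" "M > 0" "E > 0"
    using eps m by (auto simp: P_def Q_def M_def E_def intro!: zero_less_power add_pos_nonneg)
  have "n \<le> m" using m(2) by (rule le_of_le_root3)
  have "real (m choose n) \<le> 2 ^ (r + 1) * ((P * Q) * (M * E))"
    using choose_le_sparse[OF sch eps m(1)] by (simp add: P_def Q_def M_def E_def)
  then have "log 2 (real (m choose n)) \<le> log 2 (2 ^ (r + 1) * ((P * Q) * (M * E)))"
    using \<open>n \<le> m\<close> pos by (subst log_le_cancel_iff) auto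
  also have "\<dots> = real (r + 1) + (log 2 P + log 2 Q + (log 2 M + log 2 E))"
    using pos by (simp add: log_mult log_nat_power)
  also have "log 2 P = (real n + 12 * \<epsilon> * real s) * L"
    using eps by (simp add: P_def L_def log_powr)
  also have "log 2 M = real n / 3 * log 2 (real m)"
    using m by (simp add: M_def log_powr)
  finally have "log 2 (real (m choose n)) \<le> real (r + 1) +
    ((real n + 12 * \<epsilon> * real s) * L + log 2 Q + (real n / 3 * log 2 (real m) + log 2 E))" .
  moreover have "log 2 Q \<le> 3 * (\<epsilon> * real s)"
    using log2_one_plus_power_le[of \<epsilon> "2 * s"] eps by (simp add: Q_def mult_ac)
  moreover have "log 2 E \<le> 2"
    using log2_one_plus_power_le[of "1 / real m" m] m by (simp add: E_def)
  moreover have "2 * (\<epsilon> * real s) \<le> L * (\<epsilon> * real s)" using L eps by (intro mult_right_mono) auto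
  moreover have "real n * (6 * (5 + L)) \<le> real n * log 2 (real m)"
    using large by (intro mult_left_mono) (auto simp: L_def)
  moreover have "(real n + 12 * \<epsilon> * real s) * L = real n * L + 12 * (L * (\<epsilon> * real s))"
    by (simp add: algebra_simps)
  moreover have "real n * (6 * (5 + L)) = 30 * real n + 6 * (real n * L)"
    by (simp add: algebra_simps)
  moreover have "0 \<le> L * (\<epsilon> * real s)" using L eps by simp
  moreover have "real (r + 1) \<le> real n + 1" "1 \<le> real n" using m by auto
  ultimately have "real n * log 2 (real m) \<le> 84 * (L * (\<epsilon> * real s))"
    using log2_choose_ge[OF m(1,2)] by linarith
  then show ?thesis by (simp add: L_def mult_ac)
qed

section \<open>The asymptotic bound with a constant uniform in \<epsilon>\<close>

theorem theorem10:
  fixes \<epsilon>\<^sub>0 :: real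
  assumes "\<epsilon>\<^sub>0 < 1"
  shows "\<exists>c>0. \<forall>(\<epsilon>::real) (k::nat) (n :: nat \<Rightarrow> nat) (r :: nat \<Rightarrow> nat).
    0 < \<epsilon> \<and> \<epsilon> \<le> \<epsilon>\<^sub>0 \<and>
    (\<lambda>m. real (r m)) \<in> O(\<lambda>m. log 2 (real m) ^ k) \<and>
    (\<lambda>m. log 2 (real m) ^ k) \<in> o(\<lambda>m. real (n m)) \<and>
    (\<lambda>m. real (n m)) \<in> o(\<lambda>m. root 3 (real m)) \<longrightarrow>
    (\<forall>\<^sub>F m in sequentially. \<forall>s S.
       is_scheme m (n m) (r m) s S \<and> has_error m (n m) \<epsilon> S \<and>
       (\<epsilon> < 1 / 2 \<or> one_sided m (n m) S) \<longrightarrow>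
       real s \<ge> c * (real (n m) / (\<epsilon> * log 2 (1 / \<epsilon>)) * log 2 (real m)))"
proof (cases "\<epsilon>\<^sub>0 > 0")
  case False
  then show ?thesis by (intro exI[of _ 1]) auto
next
  case True
  \<comment> \<open>The first term serves \<open>\<epsilon> \<le> 1 / 4\<close>. For larger
    \<epsilon>, \<open>\<epsilon> * L\<close> is at least a quarter of
    \<open>log 2 (1 / \<epsilon>\<^sub>0)\<close>, hence at least \<open>2 * c\<close>, and the
    information bound suffices.\<close>
  define c where "c = min (1 / 84) (log 2 (1 / \<epsilon>\<^sub>0) / 8)"
  have c: "c > 0" "c \<le> 1 / 84" "c \<le> log 2 (1 / \<epsilon>\<^sub>0) / 8" using True assms by (auto simp: c_def)
  show ?thesis
  proof (intro exI[of _ c] conjI c(1) allI impI, elim conjE)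
    fix \<epsilon> :: real and k :: nat and n r :: "nat \<Rightarrow> nat"
    assume eps: "0 < \<epsilon>" "\<epsilon> \<le> \<epsilon>\<^sub>0"
      and r: "(\<lambda>m. real (r m)) \<in> O(\<lambda>m. log 2 (real m) ^ k)"
      and ln: "(\<lambda>m. log 2 (real m) ^ k) \<in> o(\<lambda>m. real (n m))"
      and n: "(\<lambda>m. real (n m)) \<in> o(\<lambda>m. root 3 (real m))"
    define L where "L = log 2 (1 / \<epsilon>)"
    have L: "L > 0" using eps assms by (simp add: L_def)
    have "\<forall>\<^sub>F m in sequentially. r m \<le> n m"
      using landau_o.smallD[OF landau_o.big_small_trans[OF r ln], of 1] by simp
    moreover have "\<forall>\<^sub>F m in sequentially. real (n m) \<le> root 3 (real m)"
      using landau_o.smallD[OF n, of 1] by simp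
    moreover have "\<forall>\<^sub>F m in sequentially. 2 powr (max 12 (6 * (5 + L))) \<le> real m"
      using filterlim_real_sequentially unfolding filterlim_at_top by blast
    then have "\<forall>\<^sub>F m in sequentially. max 12 (6 * (5 + L)) \<le> log 2 (real m)"
      using eventually_gt_at_top[of 0] by eventually_elim (subst le_log_iff, auto)
    moreover have "\<forall>\<^sub>F m in sequentially. m > 0" by (rule eventually_gt_at_top)
    ultimately show "\<forall>\<^sub>F m in sequentially. \<forall>s S.
       is_scheme m (n m) (r m) s S \<and> has_error m (n m) \<epsilon> S \<and>
       (\<epsilon> < 1 / 2 \<or> one_sided m (n m) S) \<longrightarrow>
       real s \<ge> c * (real (n m) / (\<epsilon> * log 2 (1 / \<epsilon>)) * log 2 (real m))"
    proof eventually_elim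
      case (elim m)
      show ?case
      proof (intro allI impI, elim conjE)
        fix s S
        assume sch: "is_scheme m (n m) (r m) s S" "has_error m (n m) \<epsilon> S"
          "\<epsilon> < 1 / 2 \<or> one_sided m (n m) S"
        define w where "w = real (n m) * log 2 (real m)"
        have w: "w \<ge> 0" using elim by (simp add: w_def)
        have "c * w \<le> real s * (\<epsilon> * L)" if "n m > 0"
        proof (cases "\<epsilon> \<le> 1 / 4")
          case True
          have "w \<le> 84 * (\<epsilon> * L) * real s"
            unfolding w_def L_def
            using sch eps True elim that by (intro space_bound_sparse) (auto simp: L_def)
          moreover have "c * w \<le> 1 / 84 * w" using c w by (intro mult_right_mono) auto
          ultimately show ?thesis by (simp add: mult_ac)
        next
          case False
          have "w / 2 \<le> real s"
            unfolding w_def using eps assms elim that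
            by (intro space_bound_information[OF sch]) auto
          have "log 2 (1 / \<epsilon>\<^sub>0) \<le> L"
            unfolding L_def using eps \<open>\<epsilon>\<^sub>0 > 0\<close>
            by (subst log_le_cancel_iff) (auto simp: field_simps)
          moreover have "1 / 4 * L \<le> \<epsilon> * L" using False L by (intro mult_right_mono) auto
          ultimately have "2 * c \<le> \<epsilon> * L" using c by linarith
          from mult_mono[OF \<open>w / 2 \<le> real s\<close> this] have "(w / 2) * (2 * c) \<le> real s * (\<epsilon> * L)"
            using c by simp
          then show ?thesis by (simp add: mult_ac)
        qed
        then have "c * w \<le> real s * (\<epsilon> * L)"
          using eps L by (cases "n m = 0") (auto simp: w_def)
        then have "c * w / (\<epsilon> * L) \<le> real s" using eps L by (simp add: divide_le_eq)
        then show "real s \<ge> c * (real (n m) / (\<epsilon> * log 2 (1 / \<epsilon>)) * log 2 (real m))"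
          by (simp add: w_def L_def mult_ac)
      qed
    qed
  qed
qed

end
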